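(* Every cubic ($3$-regular) simple graph $G$ of order $6$ satisfies $d_{\rm st}(G)=3$. (There are exactly two such graphs: $K_{3,3}$ and the triangular prism $K_3\square K_2$.)
   Context: For a finite simple graph $G=(V,E)$, a set $D\subseteq V$ is a strong dominating set if for every vertex $x\in V\setminus D$ there is a vertex $y\in D$ with $xy\in E$ and $\deg(x)\le \deg(y)$. A strong domatic partition of $G$ is a partition of $V(G)$ all of whose classes are strong dominating sets of $G$. The strong domatic number $d_{\rm st}(G)$ is the maximum number of classes of a strong domatic partition of $G$. *)

theory Defs
  imports "Graph_Theory.Graph_Theory" "HOL-Library.Disjoint_Sets"
begin

text \<open>
  A finite simple graph is a \<^locale>\<open>pair_graph\<close>: an edge \<open>xy\<close> is represented by the two arcs
  \<open>(x, y)\<close> and \<open>(y, x)\<close>. Because the arc set is symmetric, the out-degree of a vertex is its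
  number of neighbours. The definitions below are only meant for such graphs.
\<close>

definition deg :: "'a pair_pre_digraph \<Rightarrow> 'a \<Rightarrow> nat" where
  "deg G x = out_degree (with_proj G) x"

definition regular_graph :: "nat \<Rightarrow> 'a pair_pre_digraph \<Rightarrow> bool" where
  "regular_graph k G \<longleftrightarrow> pair_graph G \<and> (\<forall>x \<in> pverts G. deg G x = k)"

definition strong_dominating_set :: "'a pair_pre_digraph \<Rightarrow> 'a set \<Rightarrow> bool" where
  "strong_dominating_set G D \<longleftrightarrow> D \<subseteq> pverts G \<and>
     (\<forall>x \<in> pverts G - D. \<exists>y \<in> D. (x, y) \<in> parcs G \<and> deg G x \<le> deg G y)"

definition strong_domatic_partition :: "'a pair_pre_digraph \<Rightarrow> 'a set set \<Rightarrow> bool" where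
  "strong_domatic_partition G P \<longleftrightarrow>
     partition_on (pverts G) P \<and> (\<forall>D \<in> P. strong_dominating_set G D)"

definition strong_domatic_number :: "'a pair_pre_digraph \<Rightarrow> nat" where
  "strong_domatic_number G = Max {card P | P. strong_domatic_partition G P}"

text \<open>
  The set under the maximum is finite and nonempty for every finite graph, so the maximum is
  attained.
\<close>

lemma finite_strong_domatic_partitions:
  assumes "pair_graph G"
  shows "finite {card P | P. strong_domatic_partition G P}"
proof -
  interpret pair_graph G by fact
  have "{P. strong_domatic_partition G P} \<subseteq> Pow (Pow (pverts G))"
    by (auto simp: strong_domatic_partition_def partition_on_def)
  then have "finite {P. strong_domatic_partition G P}"
    by (rule finite_subset) (simp add: pair_finite_verts)
  then show ?thesis by simp
qed

lemma ex_strong_domatic_partition: "\<exists>P. strong_domatic_partition G P"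
proof (cases "pverts G = {}")
  case True
  then have "strong_domatic_partition G {}"
    by (simp add: strong_domatic_partition_def partition_on_def)
  then show ?thesis ..
next
  case False
  then have "strong_domatic_partition G {pverts G}"
    by (auto simp: strong_domatic_partition_def partition_on_def strong_dominating_set_def)
  then show ?thesis ..
qed

definition graph_iso :: "'a pair_pre_digraph \<Rightarrow> 'b pair_pre_digraph \<Rightarrow> bool" where
  "graph_iso G H \<longleftrightarrow> digraph_iso (with_proj G) (with_proj H)"

lemma graph_iso_iff:
  assumes "pair_graph G" "pair_graph H"
  shows "graph_iso G H \<longleftrightarrow> (\<exists>f. bij_betw f (pverts G) (pverts H) \<and>
    (\<forall>x \<in> pverts G. \<forall>y \<in> pverts G. (x, y) \<in> parcs G \<longleftrightarrow> (f x, f y) \<in> parcs H))"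
    (is "_ \<longleftrightarrow> (\<exists>f. ?iso f)")
proof
  interpret G: pair_graph G by fact
  interpret H: pair_graph H by fact
  assume "graph_iso G H"
  then obtain h where h: "pre_digraph.digraph_isomorphism (with_proj G) h"
      and H: "with_proj H = app_iso h (with_proj G)"
    unfolding graph_iso_def digraph_iso_def by blast
  let ?f = "iso_verts h"
  have inj: "inj_on ?f (pverts G)" and
    ends: "\<And>a. a \<in> parcs G \<Longrightarrow> ?f (fst a) = iso_tail h (iso_arcs h a) \<and>
                             ?f (snd a) = iso_head h (iso_arcs h a)"
    using h by (auto simp: G.digraph_isomorphism_def)
  have V: "pverts H = ?f ` pverts G" and A: "parcs H = iso_arcs h ` parcs G"
    and "iso_tail h = fst" "iso_head h = snd"
    using H by (auto simp: with_proj_def app_iso_def)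
  with ends have arc: "iso_arcs h a = (?f (fst a), ?f (snd a))" if "a \<in> parcs G" for a
    using that by (simp add: prod_eq_iff)
  have A': "parcs H = (\<lambda>(x, y). (?f x, ?f y)) ` parcs G"
    unfolding A by (rule image_cong) (auto simp: arc)
  have "(x, y) \<in> parcs G \<longleftrightarrow> (?f x, ?f y) \<in> parcs H"
    if xy: "x \<in> pverts G" "y \<in> pverts G" for x y
  proof
    assume "(x, y) \<in> parcs G"
    then show "(?f x, ?f y) \<in> parcs H" unfolding A' by force
  next
    assume "(?f x, ?f y) \<in> parcs H"
    then obtain u v where uv: "(u, v) \<in> parcs G" "?f x = ?f u" "?f y = ?f v"
      unfolding A' by auto
    then have "x = u" "y = v"
      using xy G.in_arcsD1[OF uv(1)] G.in_arcsD2[OF uv(1)] by (metis inj inj_onD)+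
    with uv show "(x, y) \<in> parcs G" by simp
  qed
  with inj V show "\<exists>f. ?iso f" by (auto simp: bij_betw_def)
next
  interpret G: pair_graph G by fact
  interpret H: pair_graph H by fact
  assume "\<exists>f. ?iso f"
  then obtain f where f: "?iso f" ..
  define h where "h = \<lparr>iso_verts = f, iso_arcs = (\<lambda>(x, y). (f x, f y)),
    iso_head = snd, iso_tail = fst\<rparr>"
  have inj: "inj_on f (pverts G)" and V: "pverts H = f ` pverts G"
    using f by (auto simp: bij_betw_def)
  have "inj_on (\<lambda>(x, y). (f x, f y)) (parcs G)"
    by (rule inj_onI) (clarsimp, metis G.in_arcsD1 G.in_arcsD2 inj inj_onD)
  then have "pre_digraph.digraph_isomorphism (with_proj G) h"
    using inj G.wf_digraph by (auto simp: G.digraph_isomorphism_def h_def)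
  moreover have "parcs H = (\<lambda>(x, y). (f x, f y)) ` parcs G" (is "_ = ?R")
  proof
    show "parcs H \<subseteq> ?R"
    proof
      fix a assume "a \<in> parcs H"
      moreover obtain u v where a: "a = (u, v)" by (cases a)
      ultimately have uv: "(u, v) \<in> parcs H" by simp
      obtain x y where xy: "x \<in> pverts G" "y \<in> pverts G" "u = f x" "v = f y"
        using H.in_arcsD1[OF uv] H.in_arcsD2[OF uv] unfolding V by blast
      with f uv have "(x, y) \<in> parcs G" by blast
      with xy show "a \<in> ?R" unfolding a by force
    qed
    show "?R \<subseteq> parcs H"
    proof clarify
      fix x y assume xy: "(x, y) \<in> parcs G"
      then show "(f x, f y) \<in> parcs H" using f G.in_arcsD1[OF xy] G.in_arcsD2[OF xy] by blast
    qed
  qed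
  ultimately show "graph_iso G H"
    unfolding graph_iso_def digraph_iso_def using V
    by (intro exI[of _ h]) (simp add: with_proj_def app_iso_def h_def)
qed

text \<open>
  The predicates \<^const>\<open>complete_digraph\<close> and \<^const>\<open>complete_bipartite_digraph\<close> describe complete
  and complete bipartite graphs without fixing a vertex set; here are concrete representatives.
\<close>

definition complete_graph :: "nat \<Rightarrow> nat pair_pre_digraph" where
  "complete_graph n =
     \<lparr>pverts = {..<n}, parcs = {(i, j). i < n \<and> j < n \<and> i \<noteq> j}\<rparr>"

definition complete_bipartite_graph :: "nat \<Rightarrow> nat \<Rightarrow> (nat + nat) pair_pre_digraph" where
  "complete_bipartite_graph m n =
     \<lparr>pverts = Inl ` {..<m} \<union> Inr ` {..<n},
      parcs = Inl ` {..<m} \<times> Inr ` {..<n} \<union> Inr ` {..<n} \<times> Inl ` {..<m}\<rparr>"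

lemma complete_digraph_complete_graph: "complete_digraph n (with_proj (complete_graph n))"
  unfolding complete_digraph_pair_def by (auto simp: complete_graph_def)

lemma complete_bipartite_digraph_complete_bipartite_graph:
  "complete_bipartite_digraph m n (with_proj (complete_bipartite_graph m n))"
  unfolding complete_bipartite_digraph_pair_def complete_bipartite_graph_def
  by (intro conjI exI[of _ "Inl ` {..<m}"] exI[of _ "Inr ` {..<n}"]) (auto simp: card_image)

definition cartesian_product ::
    "'a pair_pre_digraph \<Rightarrow> 'b pair_pre_digraph \<Rightarrow> ('a \<times> 'b) pair_pre_digraph" where
  "cartesian_product G H =
     \<lparr>pverts = pverts G \<times> pverts H,
      parcs = {((u, v), (u', v')) | u v u' v'.
        u = u' \<and> u \<in> pverts G \<and> (v, v') \<in> parcs H \<or>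
        v = v' \<and> v \<in> pverts H \<and> (u, u') \<in> parcs G}\<rparr>"

definition prism_graph :: "(nat \<times> nat) pair_pre_digraph" where
  "prism_graph = cartesian_product (complete_graph 3) (complete_graph 2)"

end

theory Submission
  imports Defs
begin

text \<open>
  A single vertex of a cubic graph dominates only four vertices, so the classes of a strong domatic
  partition have at least two elements and there are at most three of them.

  If the graph has a triangle \<open>A\<close>, each vertex of \<open>A\<close> sends exactly one edge out of \<open>A\<close>, while each
  of the three other vertices needs at least one edge into \<open>A\<close>. Hence these edges form a perfect
  matching, the other vertices form a triangle too, and the graph is the prism. If there is no
  triangle, the neighbours of a vertex are independent, so each of them is adjacent to all vertices
  outside this neighbourhood, and the graph is \<open>K\<^sub>3\<^sub>,\<^sub>3\<close>. In both cases the edges of a suitable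
  perfect matching are three strong dominating sets.
\<close>

section \<open>Neighbourhoods in a cubic graph of order 6\<close>

lemma deg_eq_card: "deg G x = card (parcs G `` {x})"
proof -
  have "out_arcs (with_proj G) x = Pair x ` (parcs G `` {x})"
    by (auto simp: out_arcs_def)
  then show ?thesis
    by (simp add: deg_def out_degree_def card_image inj_on_def)
qed

text \<open>Degrees are recorded through relational images, so that a list of neighbourhoods as
  explicit sets describes the graph completely.\<close>

locale cubic_graph_6 = pair_graph G for G :: "'a pair_pre_digraph" +
  assumes card_nbrs: "v \<in> pverts G \<Longrightarrow> card (parcs G `` {v}) = 3"
    and card_verts: "card (pverts G) = 6"
begin

lemma arcs_commute: "(x, y) \<in> parcs G \<longleftrightarrow> (y, x) \<in> parcs G"
  using arcs_symmetric by blast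

lemma nbrs_subset: "parcs G `` {x} \<subseteq> pverts G - {x}"
  using in_arcsD2 no_loops by fastforce

lemma nbrs_eqI:
  assumes "v \<in> pverts G" "parcs G `` {v} \<subseteq> {x, y, z}"
  shows "parcs G `` {v} = {x, y, z}"
proof (rule card_seteq)
  show "card {x, y, z} \<le> card (parcs G `` {v})"
    using card_nbrs[OF assms(1)] by (simp add: card_insert_if)
qed (use assms in auto)

lemma nbrs_eqI':
  assumes "v \<in> pverts G" "{x, y, z} \<subseteq> parcs G `` {v}" "distinct [x, y, z]"
  shows "parcs G `` {v} = {x, y, z}"
proof -
  have "finite (parcs G `` {v})"
    using card_nbrs[OF assms(1)] by (intro card_ge_0_finite) simp
  then have "{x, y, z} = parcs G `` {v}"
    using assms card_nbrs[OF assms(1)] by (intro card_seteq) auto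
  then show ?thesis ..
qed

text \<open>Used at the corners of a triangle: the two given neighbours are the other corners, and
  \<open>z\<close> is the end of the only edge leaving the triangle there.\<close>

lemma third_nbr:
  assumes "(v, x) \<in> parcs G" "(v, y) \<in> parcs G" "x \<noteq> y"
  obtains z where "parcs G `` {v} = {x, y, z}" "z \<noteq> x" "z \<noteq> y" "z \<noteq> v" "z \<in> pverts G"
proof -
  have v: "v \<in> pverts G" using assms in_arcsD1 by blast
  have "card (parcs G `` {v} - {x, y}) = 1"
    using assms card_nbrs[OF v] by (subst card_Diff_subset) auto
  then obtain z where z: "parcs G `` {v} - {x, y} = {z}"
    using card_1_singletonE by blast
  then have "parcs G `` {v} = {x, y, z}" "z \<noteq> x" "z \<noteq> y" using assms by auto
  moreover have "z \<noteq> v" "z \<in> pverts G" using z nbrs_subset[of v] by auto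
  ultimately show ?thesis using that by blast
qed

section \<open>Classification by the presence of a triangle\<close>

lemma triangle_structure:
  assumes arcs: "(a0, a1) \<in> parcs G" "(a0, a2) \<in> parcs G" "(a1, a2) \<in> parcs G"
  obtains b0 b1 b2 where
    "distinct [a0, a1, a2, b0, b1, b2]" "pverts G = {a0, a1, a2, b0, b1, b2}"
    "parcs G `` {a0} = {a1, a2, b0}" "parcs G `` {a1} = {a0, a2, b1}"
    "parcs G `` {a2} = {a0, a1, b2}" "parcs G `` {b0} = {a0, b1, b2}"
    "parcs G `` {b1} = {a1, b0, b2}" "parcs G `` {b2} = {a2, b0, b1}"
proof -
  have ne: "a0 \<noteq> a1" "a0 \<noteq> a2" "a1 \<noteq> a2"
    using arcs[THEN no_loops] by auto
  have a: "a0 \<in> pverts G" "a1 \<in> pverts G" "a2 \<in> pverts G"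
    using arcs in_arcsD1 in_arcsD2 by blast+
  obtain b0 where b0: "parcs G `` {a0} = {a1, a2, b0}" "b0 \<noteq> a1" "b0 \<noteq> a2" "b0 \<noteq> a0" "b0 \<in> pverts G"
    using arcs ne arcs_commute by (metis third_nbr)
  obtain b1 where b1: "parcs G `` {a1} = {a0, a2, b1}" "b1 \<noteq> a0" "b1 \<noteq> a2" "b1 \<noteq> a1" "b1 \<in> pverts G"
    using arcs ne arcs_commute by (metis third_nbr)
  obtain b2 where b2: "parcs G `` {a2} = {a0, a1, b2}" "b2 \<noteq> a0" "b2 \<noteq> a1" "b2 \<noteq> a2" "b2 \<in> pverts G"
    using arcs ne arcs_commute by (metis third_nbr)
  \<comment> \<open>Only one edge leaves the triangle at each corner, so an outside vertex adjacent
    to that corner is already named.\<close>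
  have into0: "v = b0" if "(v, a0) \<in> parcs G" "v \<noteq> a1" "v \<noteq> a2" for v
    using that b0 arcs_commute by blast
  have into1: "v = b1" if "(v, a1) \<in> parcs G" "v \<noteq> a0" "v \<noteq> a2" for v
    using that b1 arcs_commute by blast
  have into2: "v = b2" if "(v, a2) \<in> parcs G" "v \<noteq> a0" "v \<noteq> a1" for v
    using that b2 arcs_commute by blast
  have rest: "pverts G - {a0, a1, a2} = {b0, b1, b2}"
  proof (rule ccontr)
    assume "pverts G - {a0, a1, a2} \<noteq> {b0, b1, b2}"
    then obtain e where e: "e \<in> pverts G - {a0, a1, a2}" "e \<notin> {b0, b1, b2}"
      using b0 b1 b2 by blast
    \<comment> \<open>Since \<open>e\<close> is not the end of an edge leaving the triangle, it has
      no neighbour there, which leaves two candidates for three neighbours.\<close>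
    then have "parcs G `` {e} \<subseteq> pverts G - {a0, a1, a2, e}"
      using into0 into1 into2 nbrs_subset[of e] by auto
    then have "card (parcs G `` {e}) \<le> card (pverts G - {a0, a1, a2, e})"
      by (intro card_mono) (auto simp: pair_finite_verts)
    also have "\<dots> = 2"
      using e a ne card_verts by (subst card_Diff_subset) auto
    finally show False using card_nbrs e by simp
  qed
  \<comment> \<open>Three names exhaust a set of three elements, so they are pairwise different and
    the edges leaving the triangle form a matching.\<close>
  have "card (pverts G - {a0, a1, a2}) = 3"
    using a ne card_verts by (subst card_Diff_subset) auto
  then have ne': "b0 \<noteq> b1" "b0 \<noteq> b2" "b1 \<noteq> b2"
    unfolding rest by (auto simp: card_insert_if split: if_splits)
  have V: "pverts G = {a0, a1, a2, b0, b1, b2}"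
    using rest a by blast
  \<comment> \<open>An edge from \<open>b0\<close> to \<open>a1\<close> or \<open>a2\<close> would
    force \<open>b0 = b1\<close> or \<open>b0 = b2\<close>; only three candidates remain, and all of
    them must occur.\<close>
  have "parcs G `` {b0} = {a0, b1, b2}"
    using nbrs_subset[of b0] into1[of b0] into2[of b0] b0 ne' V by (intro nbrs_eqI) auto
  moreover have "parcs G `` {b1} = {a1, b0, b2}"
    using nbrs_subset[of b1] into0[of b1] into2[of b1] b1 ne' V by (intro nbrs_eqI) auto
  moreover have "parcs G `` {b2} = {a2, b0, b1}"
    using nbrs_subset[of b2] into0[of b2] into1[of b2] b2 ne' V by (intro nbrs_eqI) auto
  ultimately show ?thesis
    using that[of b0 b1 b2] ne ne' b0 b1 b2 V by auto
qed

lemma triangle_free_structure: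
  assumes free: "\<And>x y z. \<lbrakk>(x, y) \<in> parcs G; (x, z) \<in> parcs G\<rbrakk> \<Longrightarrow> (y, z) \<notin> parcs G"
  obtains a0 a1 a2 b0 b1 b2 where
    "distinct [a0, a1, a2, b0, b1, b2]" "pverts G = {a0, a1, a2, b0, b1, b2}"
    "\<And>a. a \<in> {a0, a1, a2} \<Longrightarrow> parcs G `` {a} = {b0, b1, b2}"
    "\<And>b. b \<in> {b0, b1, b2} \<Longrightarrow> parcs G `` {b} = {a0, a1, a2}"
proof -
  obtain a0 where a0: "a0 \<in> pverts G"
    using card_verts by fastforce
  obtain b0 b1 b2 where b: "parcs G `` {a0} = {b0, b1, b2}" "b0 \<noteq> b1" "b0 \<noteq> b2" "b1 \<noteq> b2"
    using card_nbrs[OF a0] by (auto simp: card_3_iff)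
  then have bV: "{b0, b1, b2} \<subseteq> pverts G - {a0}"
    using nbrs_subset[of a0] by simp
  \<comment> \<open>The two vertices that are neither \<open>a0\<close> nor its neighbours complete
    the side of \<open>a0\<close>.\<close>
  have "card (pverts G - {a0, b0, b1, b2}) = 2"
    using bV a0 b card_verts by (subst card_Diff_subset) auto
  then obtain a1 a2 where a: "pverts G - {a0, b0, b1, b2} = {a1, a2}" "a1 \<noteq> a2"
    by (auto simp: card_2_iff)
  then have V: "pverts G = {a0, a1, a2, b0, b1, b2}"
    using bV a0 by blast
  have distinct: "distinct [a0, a1, a2, b0, b1, b2]"
    using a b bV by auto
  have Nb: "parcs G `` {v} = {a0, a1, a2}" if v: "v \<in> {b0, b1, b2}" for v
  proof (rule nbrs_eqI)
    \<comment> \<open>An edge from \<open>v\<close> to another neighbour of \<open>a0\<close> would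
      close a triangle with \<open>a0\<close>.\<close>
    show "parcs G `` {v} \<subseteq> {a0, a1, a2}"
      using free[of a0 v] b(1) v nbrs_subset[of v] unfolding V by blast
  qed (use bV v in auto)
  have Na: "parcs G `` {v} = {b0, b1, b2}" if v: "v \<in> {a0, a1, a2}" for v
  proof (rule nbrs_eqI')
    show "{b0, b1, b2} \<subseteq> parcs G `` {v}"
      using Nb v arcs_commute by blast
  qed (use V v b in auto)
  show ?thesis using that distinct V Na Nb by blast
qed

lemma prism_or_complete_bipartite:
  obtains (prism) a0 a1 a2 b0 b1 b2 where
    "distinct [a0, a1, a2, b0, b1, b2]" "pverts G = {a0, a1, a2, b0, b1, b2}"
    "parcs G `` {a0} = {a1, a2, b0}" "parcs G `` {a1} = {a0, a2, b1}"
    "parcs G `` {a2} = {a0, a1, b2}" "parcs G `` {b0} = {a0, b1, b2}"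
    "parcs G `` {b1} = {a1, b0, b2}" "parcs G `` {b2} = {a2, b0, b1}"
  | (bipartite) a0 a1 a2 b0 b1 b2 where
    "distinct [a0, a1, a2, b0, b1, b2]" "pverts G = {a0, a1, a2, b0, b1, b2}"
    "\<And>a. a \<in> {a0, a1, a2} \<Longrightarrow> parcs G `` {a} = {b0, b1, b2}"
    "\<And>b. b \<in> {b0, b1, b2} \<Longrightarrow> parcs G `` {b} = {a0, a1, a2}"
proof (cases "\<exists>x y z. (x, y) \<in> parcs G \<and> (x, z) \<in> parcs G \<and> (y, z) \<in> parcs G")
  case True
  then obtain x y z where "(x, y) \<in> parcs G" "(x, z) \<in> parcs G" "(y, z) \<in> parcs G" by blast
  then show ?thesis by (rule triangle_structure) (rule prism)
next
  case False
  show ?thesis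
    by (rule triangle_free_structure) (use False in blast, rule bipartite)
qed

section \<open>The strong domatic number\<close>

lemma strong_dominating_set_iff:
  "strong_dominating_set G D \<longleftrightarrow>
     D \<subseteq> pverts G \<and> (\<forall>x \<in> pverts G - D. parcs G `` {x} \<inter> D \<noteq> {})"
  \<comment> \<open>All degrees equal 3, so the degree comparison always holds and ordinary
    domination remains.\<close>
  unfolding strong_dominating_set_def deg_eq_card using card_nbrs by fastforce

lemma two_le_card_strong_dominating_set:
  assumes "strong_dominating_set G D"
  shows "2 \<le> card D"
proof -
  have D: "D \<subseteq> pverts G" and fin: "finite D"
    using assms by (auto simp: strong_dominating_set_iff intro: finite_subset pair_finite_verts)
  \<comment> \<open>Domination says that \<open>D\<close> and the neighbourhoods of its elements,
    each of size 3, cover the graph; hence 6 \<le> 4 * \<open>card D\<close>.\<close>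
  have "pverts G \<subseteq> D \<union> (\<Union>y\<in>D. parcs G `` {y})"
    using assms arcs_commute unfolding strong_dominating_set_iff by blast
  then have "card (pverts G) \<le> card (D \<union> (\<Union>y\<in>D. parcs G `` {y}))"
    using fin D nbrs_subset by (intro card_mono) (auto intro: finite_subset pair_finite_verts)
  also have "\<dots> \<le> card D + (\<Sum>y\<in>D. card (parcs G `` {y}))"
    using fin by (intro order_trans[OF card_Un_le] add_left_mono card_UN_le)
  also have "\<dots> = 4 * card D"
    using D card_nbrs by (subst sum.cong[of D D _ "\<lambda>_. 3"]) auto
  finally show ?thesis using card_verts by simp
qed

lemma card_strong_domatic_partition_le:
  assumes "strong_domatic_partition G P"
  shows "card P \<le> 3"
proof -
  have P: "partition_on (pverts G) P" and dom: "\<And>D. D \<in> P \<Longrightarrow> strong_dominating_set G D"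
    using assms by (auto simp: strong_domatic_partition_def)
  have "card P * 2 \<le> (\<Sum>D\<in>P. card D)"
    using dom two_le_card_strong_dominating_set sum_bounded_below[of P 2 card] by simp
  also have "\<dots> = card (\<Union>P)"
    using P finite_elements[OF pair_finite_verts P] pair_finite_verts
    by (subst card_Union_disjoint)
      (auto simp: partition_on_def disjoint_def pairwise_def disjnt_def intro: finite_subset)
  finally show ?thesis
    using P card_verts by (simp add: partition_on_def)
qed

lemma matching_partition:
  assumes distinct: "distinct [a0, a1, a2, b0, b1, b2]"
    and V: "pverts G = {a0, a1, a2, b0, b1, b2}"
    and dom: "\<And>D. D \<in> {{a0, b0}, {a1, b1}, {a2, b2}} \<Longrightarrow> strong_dominating_set G D"
  shows "\<exists>P. strong_domatic_partition G P \<and> card P = 3"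
proof (intro exI conjI)
  let ?P = "{{a0, b0}, {a1, b1}, {a2, b2}}"
  show "strong_domatic_partition G ?P"
    unfolding strong_domatic_partition_def
    using distinct dom V by (auto simp: partition_on_def disjoint_def)
  show "card ?P = 3"
    using distinct by (auto simp: card_insert_if doubleton_eq_iff)
qed

text \<open>In the prism, the edge from \<open>a0\<close> to \<open>b0\<close> dominates each
  triangle through its end in that triangle. In the bipartite case, each end dominates the opposite
  side. The other two edges behave alike.\<close>

lemma ex_strong_domatic_partition_3: "\<exists>P. strong_domatic_partition G P \<and> card P = 3"
proof (cases rule: prism_or_complete_bipartite)
  case (prism a0 a1 a2 b0 b1 b2)
  show ?thesis
    by (rule matching_partition[OF prism(1,2)])
      (auto simp: strong_dominating_set_iff prism)
next
  case (bipartite a0 a1 a2 b0 b1 b2)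
  show ?thesis
    by (rule matching_partition[OF bipartite(1,2)])
      (auto simp: strong_dominating_set_iff bipartite)
qed

lemma strong_domatic_number_eq_3: "strong_domatic_number G = 3"
  unfolding strong_domatic_number_def
proof (rule Max_eqI)
  show "finite {card P |P. strong_domatic_partition G P}"
    by (rule finite_strong_domatic_partitions) unfold_locales
next
  show "3 \<in> {card P |P. strong_domatic_partition G P}"
    using ex_strong_domatic_partition_3 by force
qed (use card_strong_domatic_partition_le in auto)

end

section \<open>The two concrete graphs and isomorphisms to them\<close>

lemma regular_graph_complete_bipartite_graph_3:
  "regular_graph 3 (complete_bipartite_graph 3 3)"
  unfolding regular_graph_def
proof
  show "pair_graph (complete_bipartite_graph 3 3)"
    by unfold_locales (auto simp: complete_bipartite_graph_def symmetric_def intro!: symI)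
  have "parcs (complete_bipartite_graph 3 3) `` {Inl i} = Inr ` {..<3}" if "i < 3" for i
    using that by (auto simp: complete_bipartite_graph_def)
  moreover have "parcs (complete_bipartite_graph 3 3) `` {Inr i} = Inl ` {..<3}" if "i < 3" for i
    using that by (auto simp: complete_bipartite_graph_def)
  ultimately show "\<forall>x \<in> pverts (complete_bipartite_graph 3 3). deg (complete_bipartite_graph 3 3) x = 3"
    by (auto simp: deg_eq_card card_image complete_bipartite_graph_def)
qed

lemma pverts_prism_graph: "pverts prism_graph = {..<3} \<times> {..<2}"
  by (simp add: prism_graph_def cartesian_product_def complete_graph_def)

lemma arc_prism_graph_iff:
  "((u, v), (u', v')) \<in> parcs prism_graph \<longleftrightarrow>
     u < 3 \<and> u' < 3 \<and> v < 2 \<and> v' < 2 \<and> (u = u' \<and> v \<noteq> v' \<or> v = v' \<and> u \<noteq> u')"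
  by (auto simp: prism_graph_def cartesian_product_def complete_graph_def)

lemma regular_graph_prism_graph: "regular_graph 3 prism_graph"
  unfolding regular_graph_def
proof
  have "finite (parcs prism_graph)"
    by (rule finite_subset[of _ "({..<3} \<times> {..<2}) \<times> ({..<3} \<times> {..<2})"])
      (auto simp: arc_prism_graph_iff)
  then show "pair_graph prism_graph"
    by unfold_locales
      (auto simp: pverts_prism_graph arc_prism_graph_iff symmetric_def intro!: symI)
  have "card (parcs prism_graph `` {(u, v)}) = 3" if "u < 3" "v < 2" for u v
  proof -
    \<comment> \<open>One neighbour lies in the other triangle and two lie in the same
      triangle.\<close>
    have "parcs prism_graph `` {(u, v)} = Pair u ` ({..<2} - {v}) \<union> (\<lambda>u'. (u', v)) ` ({..<3} - {u})"
      using that by (auto simp: arc_prism_graph_iff)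
    also have "card \<dots> = card (Pair u ` ({..<2} - {v})) + card ((\<lambda>u'. (u', v)) ` ({..<3} - {u}))"
      by (intro card_Un_disjoint) auto
    also have "\<dots> = 3"
      using that by (simp add: card_image inj_on_def)
    finally show ?thesis .
  qed
  then show "\<forall>x \<in> pverts prism_graph. deg prism_graph x = 3"
    by (auto simp: deg_eq_card pverts_prism_graph)
qed

text \<open>A triangle of the prism would pull back to a triangle in a bipartite graph.\<close>

lemma not_graph_iso_complete_bipartite_prism:
  "\<not> graph_iso (complete_bipartite_graph 3 3) prism_graph"
proof
  let ?K = "complete_bipartite_graph 3 3"
  assume "graph_iso ?K prism_graph"
  then obtain f where bij: "bij_betw f (pverts ?K) (pverts prism_graph)"
    and iso: "\<And>x y. x \<in> pverts ?K \<Longrightarrow> y \<in> pverts ?K \<Longrightarrow>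
      (x, y) \<in> parcs ?K \<longleftrightarrow> (f x, f y) \<in> parcs prism_graph"
    using regular_graph_complete_bipartite_graph_3 regular_graph_prism_graph
    by (auto simp: graph_iso_iff regular_graph_def)
  \<comment> \<open>The vertices with second coordinate 0 form a triangle; \<open>g\<close> below
    chooses their preimages.\<close>
  have "\<exists>x \<in> pverts ?K. f x = (i, 0)" if "i < 3" for i
  proof -
    have "(i, 0) \<in> f ` pverts ?K"
      using that bij by (simp add: bij_betw_def pverts_prism_graph)
    then show ?thesis by fastforce
  qed
  then obtain g where g: "\<And>i. i < 3 \<Longrightarrow> g i \<in> pverts ?K \<and> f (g i) = (i, 0)"
    by metis
  have "(g i, g j) \<in> parcs ?K" if "i < 3" "j < 3" "i \<noteq> j" for i j
    using that g iso by (simp add: arc_prism_graph_iff)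
  \<comment> \<open>Two of the three preimages lie on the same side and so cannot be
    adjacent.\<close>
  from this[of 0 1] this[of 0 2] this[of 1 2] show False
    by (auto simp: complete_bipartite_graph_def)
qed

lemma (in cubic_graph_6) graph_iso_complete_bipartite_or_prism:
  "graph_iso G (complete_bipartite_graph 3 3) \<or> graph_iso G prism_graph"
proof (cases rule: prism_or_complete_bipartite)
  case (prism a0 a1 a2 b0 b1 b2)
  \<comment> \<open>The second coordinate tells the two triangles apart, and matched vertices share
    the first. Values outside the graph are arbitrary.\<close>
  define f :: "'a \<Rightarrow> nat \<times> nat" where "f = undefined
    (a0 := (0, 0), a1 := (1, 0), a2 := (2, 0), b0 := (0, 1), b1 := (1, 1), b2 := (2, 1))"
  have f: "f a0 = (0, 0)" "f a1 = (1, 0)" "f a2 = (2, 0)" "f b0 = (0, 1)" "f b1 = (1, 1)" "f b2 = (2, 1)"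
    using prism(1) by (auto simp: f_def)
  \<comment> \<open>This rewrites adjacency to membership in the known neighbourhoods;
    \<open>Image_singleton_iff\<close> would undo it and is therefore removed from the simplifier
    below.\<close>
  have arc: "(x, y) \<in> parcs G \<longleftrightarrow> y \<in> parcs G `` {x}" for x y by simp
  have "bij_betw f (pverts G) (pverts prism_graph)"
    unfolding bij_betw_def
    by (auto simp: prism(2) f pverts_prism_graph lessThan_nat_numeral lessThan_Suc)
  moreover have "\<forall>x \<in> pverts G. \<forall>y \<in> pverts G. (x, y) \<in> parcs G \<longleftrightarrow> (f x, f y) \<in> parcs prism_graph"
    unfolding arc using prism(1)
    by (simp add: prism(2-) f arc_prism_graph_iff del: Image_singleton_iff) (simp add: eq_commute)
  moreover have "pair_graph G" by unfold_locales
  ultimately show ?thesis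
    using regular_graph_prism_graph by (auto simp: graph_iso_iff regular_graph_def)
next
  case (bipartite a0 a1 a2 b0 b1 b2)
  \<comment> \<open>Any numbering within the sides works, because all pairs across are
    adjacent.\<close>
  define f :: "'a \<Rightarrow> nat + nat" where "f = undefined
    (a0 := Inl 0, a1 := Inl 1, a2 := Inl 2, b0 := Inr 0, b1 := Inr 1, b2 := Inr 2)"
  have f: "f a0 = Inl 0" "f a1 = Inl 1" "f a2 = Inl 2" "f b0 = Inr 0" "f b1 = Inr 1" "f b2 = Inr 2"
    using bipartite(1) by (auto simp: f_def)
  have arc: "(x, y) \<in> parcs G \<longleftrightarrow> y \<in> parcs G `` {x}" for x y by simp
  have "bij_betw f (pverts G) (pverts (complete_bipartite_graph 3 3))"
    unfolding bij_betw_def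
    by (auto simp: bipartite(2) f complete_bipartite_graph_def lessThan_nat_numeral lessThan_Suc)
  moreover have "\<forall>x \<in> pverts G. \<forall>y \<in> pverts G.
      (x, y) \<in> parcs G \<longleftrightarrow> (f x, f y) \<in> parcs (complete_bipartite_graph 3 3)"
    unfolding arc using bipartite(1)
    by (simp add: bipartite(2-) f complete_bipartite_graph_def image_iff del: Image_singleton_iff)
      (simp add: eq_commute)
  moreover have "pair_graph G" by unfold_locales
  ultimately show ?thesis
    using regular_graph_complete_bipartite_graph_3 by (auto simp: graph_iso_iff regular_graph_def)
qed

lemma cubic_graph_6I:
  assumes "regular_graph 3 G" "card (pverts G) = 6"
  shows "cubic_graph_6 G"
  using assms
  by (auto simp: regular_graph_def deg_eq_card cubic_graph_6_def cubic_graph_6_axioms_def)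

theorem theorem3p1:
  shows "(\<forall>G :: 'a pair_pre_digraph. regular_graph 3 G \<and> card (pverts G) = 6 \<longrightarrow>
           strong_domatic_number G = 3) \<and>
         (\<forall>G :: 'a pair_pre_digraph. regular_graph 3 G \<and> card (pverts G) = 6 \<longrightarrow>
           graph_iso G (complete_bipartite_graph 3 3) \<or> graph_iso G prism_graph) \<and>
         regular_graph 3 (complete_bipartite_graph 3 3) \<and>
         card (pverts (complete_bipartite_graph 3 3)) = 6 \<and>
         regular_graph 3 prism_graph \<and> card (pverts prism_graph) = 6 \<and>
         \<not> graph_iso (complete_bipartite_graph 3 3) prism_graph"
proof (intro conjI allI impI)
  fix G :: "'a pair_pre_digraph"
  assume "regular_graph 3 G \<and> card (pverts G) = 6"
  then interpret cubic_graph_6 G by (blast intro: cubic_graph_6I)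
  show "strong_domatic_number G = 3"
    by (rule strong_domatic_number_eq_3)
  show "graph_iso G (complete_bipartite_graph 3 3) \<or> graph_iso G prism_graph"
    by (rule graph_iso_complete_bipartite_or_prism)
next
  show "card (pverts (complete_bipartite_graph 3 3)) = 6"
    unfolding complete_bipartite_graph_def pair_pre_digraph.simps
    by (subst card_Un_disjoint) (auto simp: card_image)
  show "card (pverts prism_graph) = 6"
    by (simp add: pverts_prism_graph)
qed (rule regular_graph_complete_bipartite_graph_3 regular_graph_prism_graph
    not_graph_iso_complete_bipartite_prism)+

end
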